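(* For every $n\geq 1$, the exponential map $\exp:\mathbb{A}_n\to\mathbb{A}_n\setminus\{0\}$ and its restriction $\exp:\mathrm{Im}(\mathbb{A}_n)\to S(\mathbb{A}_n)$ are (well-defined) surjective maps.
   Context: The Cayley-Dickson algebras $\mathbb{A}_n=\mathbb{R}^{2^n}$ are defined by $\mathbb{A}_0=\mathbb{R}$ with $\overline{x}=x$, and $\mathbb{A}_{n+1}=\mathbb{A}_n\times\mathbb{A}_n$ with product $(a,b)(x,y)=(ax-\overline{y}b,\;ya+b\overline{x})$ and conjugation $\overline{(x_1,x_2)}=(\overline{x_1},-x_2)$. The first canonical basis vector $e_0$ is the unit, and $\mathrm{Im}(\mathbb{A}_n)$ is the span of the remaining canonical basis vectors $e_1,\dots,e_{2^n-1}$. $S(\mathbb{A}_n)=S^{2^n-1}$ is the unit sphere of $\mathbb{A}_n$ for the Euclidean norm of $\mathbb{R}^{2^n}$. The exponential is $\exp(x)=\sum_{m=0}^\infty \frac{x^m}{m!}$ (the series converges for all $x$), where $x^0=e_0$, $x^{m+1}=x^m x$ (the algebras are power-associative). *)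

theory Defs
  imports "HOL-Analysis.Analysis" "HOL-Library.Function_Algebras"
begin

text \<open>
  A vector of \<open>\<real>\<^sup>k\<close> with \<open>k = 2 ^ n\<close> is a function of type \<^typ>\<open>nat \<Rightarrow> real\<close> that vanishes from
  index \<open>2 ^ n\<close> on, because the algebras are defined by recursion on the dimension. Vector addition, subtraction
  and zero are the pointwise ones. The pointwise product and the constant function 1 of
  \<^theory>\<open>HOL-Library.Function_Algebras\<close> are not the product and the unit of the algebra.
\<close>

definition cd_carrier :: "nat \<Rightarrow> (nat \<Rightarrow> real) set" where
  "cd_carrier n = {x. \<forall>i \<ge> 2 ^ n. x i = 0}"

definition cd_basis :: "nat \<Rightarrow> nat \<Rightarrow> real" where
  "cd_basis i = (\<lambda>j. if j = i then 1 else 0)"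

definition cd_scale :: "real \<Rightarrow> (nat \<Rightarrow> real) \<Rightarrow> nat \<Rightarrow> real" where
  "cd_scale c x = (\<lambda>i. c * x i)"

text \<open>
  The identification of \<open>\<real>\<^sup>k \<times> \<real>\<^sup>k\<close> with \<open>\<real>\<^sup>2\<^sup>k\<close> for \<open>k = 2 ^ n\<close> is concatenation of coordinates.
\<close>

definition cd_pair :: "nat \<Rightarrow> (nat \<Rightarrow> real) \<Rightarrow> (nat \<Rightarrow> real) \<Rightarrow> nat \<Rightarrow> real" where
  "cd_pair n a b = (\<lambda>i. if i < 2 ^ n then a i else b (i - 2 ^ n))"

definition cd_fst :: "nat \<Rightarrow> (nat \<Rightarrow> real) \<Rightarrow> nat \<Rightarrow> real" where
  "cd_fst n x = (\<lambda>i. if i < 2 ^ n then x i else 0)"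

definition cd_snd :: "nat \<Rightarrow> (nat \<Rightarrow> real) \<Rightarrow> nat \<Rightarrow> real" where
  "cd_snd n x = (\<lambda>i. if i < 2 ^ n then x (2 ^ n + i) else 0)"

primrec cd_conj :: "nat \<Rightarrow> (nat \<Rightarrow> real) \<Rightarrow> nat \<Rightarrow> real" where
  "cd_conj 0 x = x"
| "cd_conj (Suc n) x = cd_pair n (cd_conj n (cd_fst n x)) (- cd_snd n x)"

primrec cd_mult :: "nat \<Rightarrow> (nat \<Rightarrow> real) \<Rightarrow> (nat \<Rightarrow> real) \<Rightarrow> nat \<Rightarrow> real" where
  "cd_mult 0 u v = cd_scale (u 0 * v 0) (cd_basis 0)"
| "cd_mult (Suc n) u v =
    (let a = cd_fst n u; b = cd_snd n u; x = cd_fst n v; y = cd_snd n v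
     in cd_pair n
          (cd_mult n a x - cd_mult n (cd_conj n y) b)
          (cd_mult n y a + cd_mult n b (cd_conj n x)))"

lemma cd_fst_cd_pair: "a \<in> cd_carrier n \<Longrightarrow> cd_fst n (cd_pair n a b) = a"
  by (auto simp: cd_carrier_def cd_fst_def cd_pair_def fun_eq_iff)

lemma cd_snd_cd_pair: "b \<in> cd_carrier n \<Longrightarrow> cd_snd n (cd_pair n a b) = b"
  by (auto simp: cd_carrier_def cd_snd_def cd_pair_def fun_eq_iff)

lemma cd_pair_cd_fst_cd_snd:
  "x \<in> cd_carrier (Suc n) \<Longrightarrow> cd_pair n (cd_fst n x) (cd_snd n x) = x"
  by (auto simp: cd_carrier_def cd_fst_def cd_snd_def cd_pair_def fun_eq_iff)

lemma cd_conj_cd_pair: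
  assumes "a \<in> cd_carrier n" "b \<in> cd_carrier n"
  shows "cd_conj (Suc n) (cd_pair n a b) = cd_pair n (cd_conj n a) (- b)"
  using assms by (simp add: cd_fst_cd_pair cd_snd_cd_pair)

lemma cd_mult_cd_pair:
  assumes "a \<in> cd_carrier n" "b \<in> cd_carrier n" "x \<in> cd_carrier n" "y \<in> cd_carrier n"
  shows "cd_mult (Suc n) (cd_pair n a b) (cd_pair n x y) =
    cd_pair n (cd_mult n a x - cd_mult n (cd_conj n y) b)
      (cd_mult n y a + cd_mult n b (cd_conj n x))"
  using assms by (simp add: cd_fst_cd_pair cd_snd_cd_pair)

primrec cd_power :: "nat \<Rightarrow> (nat \<Rightarrow> real) \<Rightarrow> nat \<Rightarrow> nat \<Rightarrow> real" where
  "cd_power n x 0 = cd_basis 0"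
| "cd_power n x (Suc m) = cd_mult n (cd_power n x m) x"

definition cd_norm :: "nat \<Rightarrow> (nat \<Rightarrow> real) \<Rightarrow> real" where
  "cd_norm n x = L2_set x {..<2 ^ n}"

definition cd_Im :: "nat \<Rightarrow> (nat \<Rightarrow> real) set" where
  "cd_Im n = {\<Sum>i = 1..<2 ^ n. cd_scale (c i) (cd_basis i) | c :: nat \<Rightarrow> real. True}"

definition cd_sphere :: "nat \<Rightarrow> (nat \<Rightarrow> real) set" where
  "cd_sphere n = {x \<in> cd_carrier n. cd_norm n x = 1}"

definition cd_sums :: "nat \<Rightarrow> (nat \<Rightarrow> nat \<Rightarrow> real) \<Rightarrow> (nat \<Rightarrow> real) \<Rightarrow> bool" where
  "cd_sums n f s \<longleftrightarrow>
    s \<in> cd_carrier n \<and> (\<lambda>N. cd_norm n ((\<Sum>m<N. f m) - s)) \<longlonglongrightarrow> 0"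

definition cd_exp_term :: "nat \<Rightarrow> (nat \<Rightarrow> real) \<Rightarrow> nat \<Rightarrow> nat \<Rightarrow> real" where
  "cd_exp_term n x m = cd_scale (1 / fact m) (cd_power n x m)"

definition cd_exp :: "nat \<Rightarrow> (nat \<Rightarrow> real) \<Rightarrow> nat \<Rightarrow> real" where
  "cd_exp n x = (THE s. cd_sums n (cd_exp_term n x) s)"

end

theory Submission
  imports Defs
begin

text \<open>
  Every element of the algebra has the form \<open>a e\<^sub>0 + b u\<close> with \<open>u\<close> a unit imaginary vector. As
  \<open>u\<^sup>2 = - e\<^sub>0\<close>, the plane spanned by \<open>e\<^sub>0\<close> and \<open>u\<close> is an isometric copy of the complex
  numbers, closed under multiplication, on which the exponential is the complex one. Surjectivity
  is therefore the existence of complex logarithms.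
\<close>

section \<open>Linear structure\<close>

lemma cd_fst_linear:
  "cd_fst n (x + y) = cd_fst n x + cd_fst n y"
  "cd_fst n (cd_scale c x) = cd_scale c (cd_fst n x)"
  by (auto simp: cd_fst_def cd_scale_def fun_eq_iff)

lemma cd_snd_linear:
  "cd_snd n (x + y) = cd_snd n x + cd_snd n y"
  "cd_snd n (cd_scale c x) = cd_scale c (cd_snd n x)"
  by (auto simp: cd_snd_def cd_scale_def fun_eq_iff)

lemma cd_pair_linear:
  "cd_pair n (a + b) (x + y) = cd_pair n a x + cd_pair n b y"
  "cd_pair n (cd_scale c a) (cd_scale c x) = cd_scale c (cd_pair n a x)"
  by (auto simp: cd_pair_def cd_scale_def fun_eq_iff)

lemma cd_scale_algebra:
  "cd_scale c (x + y) = cd_scale c x + cd_scale c y"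
  "cd_scale c (x - y) = cd_scale c x - cd_scale c y"
  "cd_scale (c + d) x = cd_scale c x + cd_scale d x"
  "cd_scale c (cd_scale d x) = cd_scale (c * d) x"
  by (auto simp: cd_scale_def fun_eq_iff algebra_simps)

lemma cd_scale_simps [simp]:
  "cd_scale 0 x = 0" "cd_scale c 0 = 0" "cd_scale 1 x = x" "cd_scale c (- x) = - cd_scale c x"
  by (auto simp: cd_scale_def fun_eq_iff)

lemma uminus_eq_cd_scale: "- x = cd_scale (- 1) x"
  by (auto simp: cd_scale_def fun_eq_iff)

lemma cd_conj_linear:
  "cd_conj n (x + y) = cd_conj n x + cd_conj n y"
  "cd_conj n (cd_scale c x) = cd_scale c (cd_conj n x)"
proof (induction n arbitrary: x y)
  case (Suc n)
  { case 1 show ?case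
      by (simp only: cd_conj.simps cd_fst_linear cd_snd_linear Suc.IH minus_add_distrib cd_pair_linear(1)) }
  { case 2 show ?case
      by (simp add: cd_fst_linear cd_snd_linear Suc.IH flip: cd_pair_linear(2)) }
qed auto

text \<open>Bilinearity passes through each doubling because the two projections and the conjugation
  are linear. It reduces products in a complex plane to products of \<open>e\<^sub>0\<close> and
  \<open>u\<close>.\<close>

lemma cd_mult_linear:
  "cd_mult n (x + y) z = cd_mult n x z + cd_mult n y z"
  "cd_mult n (cd_scale c x) z = cd_scale c (cd_mult n x z)"
  "cd_mult n z (x + y) = cd_mult n z x + cd_mult n z y"
  "cd_mult n z (cd_scale c x) = cd_scale c (cd_mult n z x)"
proof (induction n arbitrary: x y z)
  case 0
  { case 1 show ?case by (simp add: cd_scale_def fun_eq_iff algebra_simps) }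
  { case 2 show ?case by (simp add: cd_scale_def fun_eq_iff) }
  { case 3 show ?case by (simp add: cd_scale_def fun_eq_iff algebra_simps) }
  { case 4 show ?case by (simp add: cd_scale_def fun_eq_iff) }
next
  case (Suc n)
  note lin = cd_fst_linear cd_snd_linear cd_conj_linear Suc.IH cd_mult.simps Let_def
  { case 1 show ?case
      \<comment> \<open>The sum of two pairs on the right is merged into one pair, so the two sides
        differ only by the order of summands within each component.\<close>
      by (simp only: lin cd_pair_linear(1)[symmetric]) (simp only: algebra_simps) }
  { case 2 show ?case
      by (simp add: lin flip: cd_pair_linear(2) cd_scale_algebra(1,2)) }
  { case 3 show ?case
      by (simp only: lin cd_pair_linear(1)[symmetric]) (simp only: algebra_simps) }
  { case 4 show ?case
      by (simp add: lin flip: cd_pair_linear(2) cd_scale_algebra(1,2)) }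
qed

lemma cd_mult_zero [simp]: "cd_mult n 0 x = 0" "cd_mult n x 0 = 0"
  using cd_mult_linear(2)[of n 0 0 x] cd_mult_linear(4)[of n x 0 0] by simp_all

lemma cd_mult_minus [simp]:
  "cd_mult n (- x) y = - cd_mult n x y" "cd_mult n x (- y) = - cd_mult n x y"
  using cd_mult_linear(2)[of n "-1" x y] cd_mult_linear(4)[of n x "-1" y]
  by (simp_all flip: uminus_eq_cd_scale)

lemma cd_conj_zero [simp]: "cd_conj n 0 = 0"
  using cd_conj_linear(2)[of n 0 0] by simp

lemma cd_carrier_fst_snd: "cd_fst n x \<in> cd_carrier n" "cd_snd n x \<in> cd_carrier n"
  by (auto simp: cd_carrier_def cd_fst_def cd_snd_def)

lemma cd_basis_0_mem: "cd_basis 0 \<in> cd_carrier n"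
  by (auto simp: cd_carrier_def cd_basis_def)

lemma cd_carrier_scale: "x \<in> cd_carrier n \<Longrightarrow> cd_scale c x \<in> cd_carrier n"
  by (auto simp: cd_carrier_def cd_scale_def)

lemma cd_carrier_add: "x \<in> cd_carrier n \<Longrightarrow> y \<in> cd_carrier n \<Longrightarrow> x + y \<in> cd_carrier n"
  by (auto simp: cd_carrier_def)

section \<open>Unit and conjugation\<close>

lemma cd_fst_basis_0 [simp]: "cd_fst n (cd_basis 0) = cd_basis 0"
  by (auto simp: cd_fst_def cd_basis_def fun_eq_iff)

lemma cd_snd_basis_0 [simp]: "cd_snd n (cd_basis 0) = 0"
  by (auto simp: cd_snd_def cd_basis_def fun_eq_iff)

lemma cd_pair_basis_0 [simp]: "cd_pair n (cd_basis 0) 0 = cd_basis 0"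
  by (auto simp: cd_pair_def cd_basis_def fun_eq_iff)

lemma cd_conj_basis_0 [simp]: "cd_conj n (cd_basis 0) = cd_basis 0"
  by (induction n) auto

lemma cd_conj_mem: "x \<in> cd_carrier n \<Longrightarrow> cd_conj n x \<in> cd_carrier n"
  by (cases n) (auto simp: cd_carrier_def cd_pair_def cd_snd_def)

text \<open>Both laws share one induction: for the left factor (e0, 0) the second component of the
  product is y e0, which calls for the right unit law one level down.\<close>

lemma cd_mult_unit:
  "x \<in> cd_carrier n \<Longrightarrow> cd_mult n (cd_basis 0) x = x"
  "x \<in> cd_carrier n \<Longrightarrow> cd_mult n x (cd_basis 0) = x"
proof (induction n arbitrary: x)
  case 0
  { case 1 then show ?case
      by (auto simp: cd_carrier_def cd_scale_def cd_basis_def fun_eq_iff) }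
  { case 2 then show ?case
      by (auto simp: cd_carrier_def cd_scale_def cd_basis_def fun_eq_iff) }
next
  case (Suc n)
  note simps = Let_def Suc.IH cd_carrier_fst_snd cd_pair_cd_fst_cd_snd
  { case 1 then show ?case by (simp add: simps) }
  { case 2 then show ?case by (simp add: simps) }
qed

lemma cd_conj_imaginary: "x \<in> cd_carrier n \<Longrightarrow> x 0 = 0 \<Longrightarrow> cd_conj n x = - x"
proof (induction n arbitrary: x)
  case 0
  \<comment> \<open>In dimension one, index 0 is the only coordinate, so \<open>x\<close> is
    zero.\<close>
  then show ?case by (auto simp: cd_carrier_def fun_eq_iff) (metis Suc_leI gr0I)
next
  case (Suc n)
  have "cd_conj n (cd_fst n x) = - cd_fst n x"
    using Suc.prems by (intro Suc.IH cd_carrier_fst_snd) (simp add: cd_fst_def)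
  then have "cd_conj (Suc n) x = - cd_pair n (cd_fst n x) (cd_snd n x)"
    by (auto simp: cd_pair_def fun_eq_iff)
  then show ?case
    using Suc.prems(1) by (simp add: cd_pair_cd_fst_cd_snd)
qed

lemma sum_squares_split:
  "(\<Sum>i<2 ^ Suc n. (x i)\<^sup>2) = (\<Sum>i<2 ^ n. (cd_fst n x i)\<^sup>2) + (\<Sum>i<2 ^ n. (cd_snd n x i)\<^sup>2)"
  for x :: "nat \<Rightarrow> real"
proof -
  have "(\<Sum>i<2 ^ Suc n. (x i)\<^sup>2) = (\<Sum>i<2 ^ n. (x i)\<^sup>2) + (\<Sum>i = 2 ^ n..<2 ^ n + 2 ^ n. (x i)\<^sup>2)"
    using sum.atLeastLessThan_concat[of 0 "2 ^ n" "2 ^ n + 2 ^ n" "\<lambda>i. (x i)\<^sup>2"]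
    by (simp add: lessThan_atLeast0 mult_2)
  also have "(\<Sum>i = 2 ^ n..<2 ^ n + 2 ^ n. (x i)\<^sup>2) = (\<Sum>i<2 ^ n. (x (2 ^ n + i))\<^sup>2)"
    using sum.shift_bounds_nat_ivl[of "\<lambda>i. (x i)\<^sup>2" 0 "2 ^ n" "2 ^ n"]
    by (simp add: lessThan_atLeast0 add.commute)
  finally show ?thesis
    by (simp add: cd_fst_def cd_snd_def)
qed

text \<open>For x = (a, b) the conjugate is (a', -b), with a' and b' the conjugates of a and b. The
  product has first component a'a + b'b, covered by induction, and second component ba' - ba' =
  0.\<close>

lemma cd_conj_mult_self: "cd_mult n (cd_conj n x) x = cd_scale (\<Sum>i<2 ^ n. (x i)\<^sup>2) (cd_basis 0)"
proof (induction n arbitrary: x)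
  case 0
  then show ?case by (simp add: power2_eq_square lessThan_Suc)
next
  case (Suc n)
  let ?a = "cd_conj n (cd_fst n x)" and ?b = "cd_snd n x"
  have a: "?a \<in> cd_carrier n"
    by (intro cd_conj_mem cd_carrier_fst_snd)
  have b: "- ?b \<in> cd_carrier n"
    using cd_carrier_fst_snd(2)[of n x] by (simp add: cd_carrier_def)
  let ?s = "(\<Sum>i<2 ^ n. (cd_fst n x i)\<^sup>2) + (\<Sum>i<2 ^ n. (cd_snd n x i)\<^sup>2)"
  have "cd_mult (Suc n) (cd_conj (Suc n) x) x = cd_pair n (cd_scale ?s (cd_basis 0)) 0"
    by (simp add: Let_def cd_fst_cd_pair[OF a] cd_snd_cd_pair[OF b] Suc.IH cd_scale_algebra(3))
  also have "\<dots> = cd_scale ?s (cd_pair n (cd_basis 0) 0)"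
    by (simp only: cd_pair_linear(2)[symmetric] cd_scale_simps(2))
  finally show ?case
    by (simp only: sum_squares_split cd_pair_basis_0)
qed

text \<open>Conjugation negates \<open>u\<close>, so this is \<open>cd_conj_mult_self\<close> with
  the sign moved across. For a unit vector it says that \<open>u\<close> is a square root of
  -1.\<close>

lemma cd_mult_self_imaginary:
  assumes "u \<in> cd_carrier n" "u 0 = 0"
  shows "cd_mult n u u = - cd_scale ((cd_norm n u)\<^sup>2) (cd_basis 0)"
proof -
  have "(cd_norm n u)\<^sup>2 = (\<Sum>i<2 ^ n. (u i)\<^sup>2)"
    by (simp add: cd_norm_def L2_set_def sum_nonneg)
  then show ?thesis
    using cd_conj_mult_self[of n u] cd_conj_imaginary[OF assms] by (metis cd_mult_minus(1) minus_minus)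
qed

section \<open>Complex planes\<close>

definition cd_of_complex :: "(nat \<Rightarrow> real) \<Rightarrow> complex \<Rightarrow> nat \<Rightarrow> real" where
  "cd_of_complex u z = cd_scale (Re z) (cd_basis 0) + cd_scale (Im z) u"

definition cd_imaginary_unit :: "nat \<Rightarrow> (nat \<Rightarrow> real) \<Rightarrow> bool" where
  "cd_imaginary_unit n u \<longleftrightarrow> u \<in> cd_carrier n \<and> u 0 = 0 \<and> cd_norm n u = 1"

lemma cd_of_complex_mem: "cd_imaginary_unit n u \<Longrightarrow> cd_of_complex u z \<in> cd_carrier n"
  by (simp add: cd_of_complex_def cd_imaginary_unit_def cd_carrier_add cd_carrier_scale cd_basis_0_mem)

lemma cd_of_complex_at_0: "cd_imaginary_unit n u \<Longrightarrow> cd_of_complex u z 0 = Re z"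
  by (simp add: cd_of_complex_def cd_imaginary_unit_def cd_scale_def cd_basis_def)

text \<open>By bilinearity only the four products of \<open>e\<^sub>0\<close> and \<open>u\<close>
  matter, and these match those of 1 and i.\<close>

lemma cd_mult_of_complex:
  assumes "cd_imaginary_unit n u"
  shows "cd_mult n (cd_of_complex u z) (cd_of_complex u w) = cd_of_complex u (z * w)"
proof -
  have "u \<in> cd_carrier n" "cd_mult n u u = - cd_basis 0"
    using assms cd_mult_self_imaginary[of u n] by (auto simp: cd_imaginary_unit_def)
  then show ?thesis
    unfolding cd_of_complex_def
    by (simp add: cd_mult_linear cd_mult_unit cd_basis_0_mem)
       (simp add: cd_scale_def fun_eq_iff algebra_simps)
qed

lemma cd_power_of_complex:
  assumes "cd_imaginary_unit n u"
  shows "cd_power n (cd_of_complex u z) m = cd_of_complex u (z ^ m)"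
proof (induction m)
  case 0
  show ?case by (simp add: cd_of_complex_def)
next
  case (Suc m)
  \<comment> \<open>\<open>cd_power\<close> multiplies by the base on the right;
    \<open>power_Suc2\<close> unfolds the complex power on the same side.\<close>
  then show ?case by (simp add: cd_mult_of_complex[OF assms] power_Suc2 del: power_Suc)
qed

lemma cd_norm_of_complex:
  assumes "cd_imaginary_unit n u"
  shows "cd_norm n (cd_of_complex u z) = cmod z"
proof -
  have u: "u 0 = 0" "(\<Sum>i<2 ^ n. (u i)\<^sup>2) = 1"
    using assms by (auto simp: cd_imaginary_unit_def cd_norm_def L2_set_def)
  \<comment> \<open>There is no cross term: \<open>cd_basis 0\<close> lives at index 0 only, where
    \<open>u\<close> vanishes.\<close>
  have "(cd_of_complex u z i)\<^sup>2 = (if i = 0 then (Re z)\<^sup>2 else 0) + (Im z)\<^sup>2 * (u i)\<^sup>2" for i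
    using u(1) by (auto simp: cd_of_complex_def cd_scale_def cd_basis_def power_mult_distrib)
  then have "(\<Sum>i<2 ^ n. (cd_of_complex u z i)\<^sup>2) = (Re z)\<^sup>2 + (Im z)\<^sup>2 * (\<Sum>i<2 ^ n. (u i)\<^sup>2)"
    by (simp add: sum.distrib sum_distrib_left sum.delta)
  then show ?thesis
    by (simp add: cd_norm_def L2_set_def u(2) cmod_def)
qed

text \<open>The unit \<open>u\<close> is the normalised imaginary part \<open>p\<close> of
  \<open>x\<close>, and \<open>cd_norm n p\<close> becomes the imaginary part of \<open>z\<close>. A
  real \<open>x\<close> determines no direction, so one has to be chosen.\<close>

lemma exists_cd_of_complex:
  assumes "n \<ge> 1" "x \<in> cd_carrier n"
  obtains u z where "cd_imaginary_unit n u" "x = cd_of_complex u z"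
proof -
  define p where "p = x(0 := 0)"
  have p: "p \<in> cd_carrier n" "p 0 = 0"
    using assms by (auto simp: p_def cd_carrier_def)
  have x: "x = cd_scale (x 0) (cd_basis 0) + p"
    by (auto simp: p_def cd_scale_def cd_basis_def fun_eq_iff)
  show thesis
  proof (cases "cd_norm n p = 0")
    case True
    then have "\<forall>i<2 ^ n. p i = 0"
      by (simp add: cd_norm_def L2_set_eq_0_iff)
    then have "p = 0"
      using p(1) by (auto simp: cd_carrier_def fun_eq_iff) (metis not_less)
    \<comment> \<open>This is where \<open>n \<ge> 1\<close> enters: index 1 lies below
      \<open>2 ^ n\<close>, so \<open>cd_basis 1\<close> is an imaginary unit of the
      algebra.\<close>
    have "(2::nat) ^ 1 \<le> 2 ^ n"
      using assms(1) by (intro power_increasing) auto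
    then have "cd_imaginary_unit n (cd_basis 1)"
      by (auto simp: cd_imaginary_unit_def cd_carrier_def cd_basis_def cd_norm_def L2_set_def
          if_distrib[of "\<lambda>x. x\<^sup>2"] cong: if_cong)
    moreover have "x = cd_of_complex (cd_basis 1) (Complex (x 0) 0)"
      using x \<open>p = 0\<close> by (simp add: cd_of_complex_def)
    ultimately show thesis by (rule that)
  next
    case False
    have "cd_norm n (cd_scale (1 / cd_norm n p) p) = 1"
      using False L2_set_right_distrib[of "1 / cd_norm n p" p "{..<2 ^ n}"]
      by (simp add: cd_norm_def cd_scale_def)
    then have "cd_imaginary_unit n (cd_scale (1 / cd_norm n p) p)"
      using p by (simp add: cd_imaginary_unit_def cd_carrier_scale) (simp add: cd_scale_def)
    moreover have "x = cd_of_complex (cd_scale (1 / cd_norm n p) p) (Complex (x 0) (cd_norm n p))"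
      using False by (subst x) (simp add: cd_of_complex_def cd_scale_algebra)
    ultimately show thesis by (rule that)
  qed
qed

section \<open>The exponential\<close>

lemma sum_fun_apply: "(\<Sum>m\<in>A. f m) i = (\<Sum>m\<in>A. f m i)"
  for f :: "'a \<Rightarrow> 'b \<Rightarrow> real"
  by (induction A rule: infinite_finite_induct) auto

text \<open>In finite dimension, convergence in norm is convergence of every coordinate, which
  brings in the library of real series.\<close>

lemma cd_sums_iff:
  "cd_sums n f s \<longleftrightarrow> s \<in> cd_carrier n \<and> (\<forall>i<2 ^ n. (\<lambda>m. f m i) sums s i)"
proof -
  define d where "d N = (\<Sum>m<N. f m) - s" for N
  have d: "(\<lambda>m. f m i) sums s i \<longleftrightarrow> (\<lambda>N. d N i) \<longlonglongrightarrow> 0" for i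
    by (simp add: sums_def d_def sum_fun_apply LIM_zero_iff)
  have "(\<lambda>N. d N i) \<longlonglongrightarrow> 0" if "(\<lambda>N. cd_norm n (d N)) \<longlonglongrightarrow> 0" "i < 2 ^ n" for i
  proof (rule Lim_null_comparison[OF _ that(1)])
    have "\<bar>d N i\<bar> \<le> cd_norm n (d N)" for N
      \<comment> \<open>Taking absolute values first leaves the norm unchanged and bounds the
        coordinate from both sides.\<close>
      using member_le_L2_set[of "{..<2 ^ n}" i "\<lambda>i. \<bar>d N i\<bar>"] that(2)
      by (simp add: cd_norm_def L2_set_def)
    then show "\<forall>\<^sub>F N in sequentially. norm (d N i) \<le> cd_norm n (d N)"
      by simp
  qed
  moreover have "(\<lambda>N. cd_norm n (d N)) \<longlonglongrightarrow> 0" if "\<forall>i<2 ^ n. (\<lambda>N. d N i) \<longlonglongrightarrow> 0"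
  proof -
    have "(\<lambda>N. sqrt (\<Sum>i<2 ^ n. (d N i)\<^sup>2)) \<longlonglongrightarrow> sqrt (\<Sum>i<(2::nat) ^ n. 0\<^sup>2)"
      using that by (intro tendsto_intros) auto
    then show ?thesis
      by (simp add: cd_norm_def L2_set_def)
  qed
  ultimately show ?thesis
    by (auto simp: cd_sums_def d simp flip: d_def)
qed

text \<open>Ensures that the definite description in \<open>cd_exp\<close> picks out the sum once
  some sum is known.\<close>

lemma cd_sums_unique: "cd_sums n f s \<Longrightarrow> cd_sums n f t \<Longrightarrow> s = t"
  by (auto simp: cd_sums_iff cd_carrier_def fun_eq_iff) (metis not_less sums_unique2)

text \<open>Each coordinate of the series is a fixed real combination of the real and imaginary
  parts of the complex exponential series.\<close>

lemma cd_sums_exp_of_complex: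
  assumes "cd_imaginary_unit n u"
  shows "cd_sums n (cd_exp_term n (cd_of_complex u z)) (cd_of_complex u (exp z))"
proof -
  have exp: "(\<lambda>m. z ^ m /\<^sub>R fact m) sums exp z"
    by (rule exp_converges)
  have "(\<lambda>m. Re (z ^ m /\<^sub>R fact m) * cd_basis 0 i + Im (z ^ m /\<^sub>R fact m) * u i)
      sums (Re (exp z) * cd_basis 0 i + Im (exp z) * u i)" for i
    by (intro sums_add sums_mult2 sums_Re sums_Im exp)
  moreover have "cd_exp_term n (cd_of_complex u z) m i
      = Re (z ^ m /\<^sub>R fact m) * cd_basis 0 i + Im (z ^ m /\<^sub>R fact m) * u i" for m i
    unfolding cd_exp_term_def cd_power_of_complex[OF assms]
    by (simp add: cd_of_complex_def cd_scale_def field_simps)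
  ultimately show ?thesis
    using cd_of_complex_mem[OF assms]
    by (simp add: cd_sums_iff) (simp add: cd_of_complex_def cd_scale_def)
qed

lemma cd_exp_of_complex:
  assumes "cd_imaginary_unit n u"
  shows "cd_exp n (cd_of_complex u z) = cd_of_complex u (exp z)"
  unfolding cd_exp_def
  using cd_sums_exp_of_complex[OF assms] by (blast intro: cd_sums_unique)

section \<open>Imaginary space, zero and sphere seen from a complex plane\<close>

lemma cd_Im_eq: "cd_Im n = {x \<in> cd_carrier n. x 0 = 0}"
proof -
  have *: "(\<Sum>i = 1..<2 ^ n. cd_scale (c i) (cd_basis i)) j = (if j \<in> {1..<2 ^ n} then c j else 0)"
    for c j
    by (simp add: sum_fun_apply cd_scale_def cd_basis_def if_distrib[of "(*) _"] cong: if_cong)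
  show ?thesis
  proof (intro set_eqI iffI)
    fix x assume "x \<in> cd_Im n"
    then show "x \<in> {x \<in> cd_carrier n. x 0 = 0}"
      by (auto simp: cd_Im_def cd_carrier_def * simp del: One_nat_def)
  next
    fix x assume "x \<in> {x \<in> cd_carrier n. x 0 = 0}"
    \<comment> \<open>The coefficients are the coordinates of \<open>x\<close> themselves.\<close>
    then have "x = (\<Sum>i = 1..<2 ^ n. cd_scale (x i) (cd_basis i))"
      by (intro ext, subst *) (auto simp: cd_carrier_def not_less Suc_le_eq)
    then show "x \<in> cd_Im n"
      unfolding cd_Im_def by blast
  qed
qed

lemma cd_of_complex_eq_0_iff:
  assumes "cd_imaginary_unit n u"
  shows "cd_of_complex u z = 0 \<longleftrightarrow> z = 0"
proof
  assume "cd_of_complex u z = 0"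
  then have "cmod z = cd_norm n 0"
    using cd_norm_of_complex[OF assms, of z] by simp
  then show "z = 0"
    by (simp add: cd_norm_def L2_set_def)
qed (simp add: cd_of_complex_def)

lemma cd_of_complex_in_Im_iff:
  "cd_imaginary_unit n u \<Longrightarrow> cd_of_complex u z \<in> cd_Im n \<longleftrightarrow> Re z = 0"
  by (simp add: cd_Im_eq cd_of_complex_mem cd_of_complex_at_0)

lemma cd_of_complex_in_sphere_iff:
  "cd_imaginary_unit n u \<Longrightarrow> cd_of_complex u z \<in> cd_sphere n \<longleftrightarrow> cmod z = 1"
  by (simp add: cd_sphere_def cd_of_complex_mem cd_norm_of_complex)

text \<open>The first conjunct says that the series converges to \<open>cd_exp n x\<close>. Each
  image equation combines landing in the target with surjectivity onto it.\<close>

theorem theorem2p1: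
  fixes n :: nat
  assumes "n \<ge> 1"
  shows "(\<forall>x \<in> cd_carrier n. cd_sums n (cd_exp_term n x) (cd_exp n x))
    \<and> cd_exp n ` cd_carrier n = cd_carrier n - {0}
    \<and> cd_exp n ` cd_Im n = cd_sphere n"
proof (intro conjI ballI equalityI subsetI)
  fix x assume "x \<in> cd_carrier n"
  then obtain u z where "cd_imaginary_unit n u" "x = cd_of_complex u z"
    using exists_cd_of_complex[OF assms] by metis
  then show "cd_sums n (cd_exp_term n x) (cd_exp n x)"
    by (simp add: cd_exp_of_complex cd_sums_exp_of_complex)
next
  fix y assume "y \<in> cd_exp n ` cd_carrier n"
  then obtain u z where "cd_imaginary_unit n u" "y = cd_exp n (cd_of_complex u z)"
    using exists_cd_of_complex[OF assms] by (metis imageE)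
  \<comment> \<open>The complex exponential never vanishes, and \<open>cd_of_complex u\<close> sends
    only 0 to 0.\<close>
  then show "y \<in> cd_carrier n - {0}"
    by (simp add: cd_exp_of_complex cd_of_complex_mem cd_of_complex_eq_0_iff)
next
  fix y assume y: "y \<in> cd_carrier n - {0}"
  then obtain u z where u: "cd_imaginary_unit n u" "y = cd_of_complex u z"
    using exists_cd_of_complex[OF assms] by (metis DiffD1)
  \<comment> \<open>Since \<open>y\<close> is nonzero, so is \<open>z\<close>, and
    \<open>exp (Ln z) = z\<close>.\<close>
  then have "y = cd_exp n (cd_of_complex u (Ln z))"
    using y by (simp add: cd_exp_of_complex cd_of_complex_eq_0_iff)
  then show "y \<in> cd_exp n ` cd_carrier n"
    using cd_of_complex_mem[OF u(1)] by blast
next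
  fix y assume "y \<in> cd_exp n ` cd_Im n"
  then obtain x where x: "x \<in> cd_Im n" "y = cd_exp n x"
    by blast
  then obtain u z where "cd_imaginary_unit n u" "x = cd_of_complex u z"
    using exists_cd_of_complex[OF assms] by (metis (lifting) cd_Im_eq mem_Collect_eq)
  \<comment> \<open>Here \<open>Re z = 0\<close>, so the modulus of \<open>exp z\<close> is
    \<open>exp 0 = 1\<close>.\<close>
  then show "y \<in> cd_sphere n"
    using x by (simp add: cd_exp_of_complex cd_of_complex_in_sphere_iff cd_of_complex_in_Im_iff)
next
  fix y assume y: "y \<in> cd_sphere n"
  then obtain u z where u: "cd_imaginary_unit n u" "y = cd_of_complex u z"
    using exists_cd_of_complex[OF assms] by (metis (lifting) cd_sphere_def mem_Collect_eq)
  then have "cmod z = 1" "z \<noteq> 0"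
    using y by (auto simp: cd_of_complex_in_sphere_iff)
  \<comment> \<open>The real part of \<open>Ln z\<close> is \<open>ln (cmod z) = 0\<close>, so the
    preimage is imaginary.\<close>
  then have "y = cd_exp n (cd_of_complex u (Ln z))" "cd_of_complex u (Ln z) \<in> cd_Im n"
    using u by (simp_all add: cd_exp_of_complex cd_of_complex_in_Im_iff)
  then show "y \<in> cd_exp n ` cd_Im n"
    by blast
qed

end
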